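(* Let $\mathcal{I}$ denote the intercalate and let $k\ge 1$. Then $\mathrm{scc}(\mathcal{I}^k)=k+1$.
   Context: A Latin square is identified with its set of entries $(r,c,s)$ (symbol $s$ in row $r$, column $c$). The intercalate $\mathcal{I}$ is the unique (up to relabeling) Latin square of order $2$. Given Latin squares $L_1\subseteq R_1\times C_1\times S_1$ and $L_2\subseteq R_2\times C_2\times S_2$, their product $L_1\times L_2\subseteq (R_1\times R_2)\times(C_1\times C_2)\times(S_1\times S_2)$ consists of the entries $((r_1,r_2),(c_1,c_2),(s_1,s_2))$ for all $(r_1,c_1,s_1)\in L_1$ and $(r_2,c_2,s_2)\in L_2$. Set $\mathcal{I}^1=\mathcal{I}$ and $\mathcal{I}^k=\mathcal{I}^{k-1}\times\mathcal{I}$. A line of a Latin square $L$ is the set of entries in a fixed row, fixed column, or with a fixed symbol. A subsquare of $L$ is a subset of entries that is itself a Latin square; it intersects a line $\ell$ if it contains an entry of $\ell$. A chain of $L$ is a sequence of subsquares $\emptyset=S_0\subseteq S_1\subseteq\cdots\subseteq S_\alpha=L$ with $S_1$ a single entry. It is connected if for each $1\le i\le\alpha$ there is a line $\ell$ intersecting $S_i$ but not $S_{i-1}$ such that $S_i$ is the smallest subsquare of $L$ intersecting $\ell$ and containing all entries of $S_{i-1}$. Its length is $\alpha$; $\mathrm{scc}(L)$ is the minimum length of a connected chain of $L$. *)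

theory Defs
  imports Main
begin

type_synonym ('r, 'c, 's) entry = "'r \<times> 'c \<times> 's"

definition rows :: "('r, 'c, 's) entry set \<Rightarrow> 'r set" where
  "rows L = {r. \<exists>c s. (r, c, s) \<in> L}"

definition cols :: "('r, 'c, 's) entry set \<Rightarrow> 'c set" where
  "cols L = {c. \<exists>r s. (r, c, s) \<in> L}"

definition syms :: "('r, 'c, 's) entry set \<Rightarrow> 's set" where
  "syms L = {s. \<exists>r c. (r, c, s) \<in> L}"

text \<open>The empty set is the Latin square of order 0; chains start with it.\<close>

definition latin_square_of_order :: "nat \<Rightarrow> ('r, 'c, 's) entry set \<Rightarrow> bool" where
  "latin_square_of_order n L \<longleftrightarrow>
     finite L \<and> card (rows L) = n \<and> card (cols L) = n \<and> card (syms L) = n \<and>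
     (\<forall>r\<in>rows L. \<forall>c\<in>cols L. \<exists>!s. (r, c, s) \<in> L) \<and>
     (\<forall>r\<in>rows L. \<forall>s\<in>syms L. \<exists>!c. (r, c, s) \<in> L) \<and>
     (\<forall>c\<in>cols L. \<forall>s\<in>syms L. \<exists>!r. (r, c, s) \<in> L)"

definition latin_square :: "('r, 'c, 's) entry set \<Rightarrow> bool" where
  "latin_square L \<longleftrightarrow> (\<exists>n. latin_square_of_order n L)"

definition intercalate :: "('r, 'c, 's) entry set \<Rightarrow> bool" where
  "intercalate I \<longleftrightarrow> latin_square_of_order 2 I"

definition latin_prod ::
  "('r1, 'c1, 's1) entry set \<Rightarrow> ('r2, 'c2, 's2) entry set \<Rightarrow>
   ('r1 \<times> 'r2, 'c1 \<times> 'c2, 's1 \<times> 's2) entry set" where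
  "latin_prod L1 L2 =
     {((r1, r2), (c1, c2), (s1, s2)) | r1 r2 c1 c2 s1 s2.
        (r1, c1, s1) \<in> L1 \<and> (r2, c2, s2) \<in> L2}"

text \<open>
  The labels of the \<open>k\<close>-th power are iterated pairs, whose type would depend on \<open>k\<close>.
  They are encoded as lists of length \<open>k\<close>: \<open>a\<close> becomes \<open>[a]\<close> and the pair \<open>(x, a)\<close>
  becomes \<open>x @ [a]\<close>. The equation for \<open>0\<close> is a mere convention.
\<close>

fun latin_power ::
  "('r, 'c, 's) entry set \<Rightarrow> nat \<Rightarrow> ('r list, 'c list, 's list) entry set" where
  "latin_power L 0 = {([], [], [])}"
| "latin_power L (Suc 0) = {([r], [c], [s]) | r c s. (r, c, s) \<in> L}"
| "latin_power L (Suc (Suc k)) =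
     {(r1 @ [r2], c1 @ [c2], s1 @ [s2]) | r1 r2 c1 c2 s1 s2.
        ((r1, r2), (c1, c2), (s1, s2)) \<in> latin_prod (latin_power L (Suc k)) L}"

definition lines :: "('r, 'c, 's) entry set \<Rightarrow> ('r, 'c, 's) entry set set" where
  "lines L =
     {{(r', c, s) \<in> L. r' = r} | r. r \<in> rows L} \<union>
     {{(r, c', s) \<in> L. c' = c} | c. c \<in> cols L} \<union>
     {{(r, c, s') \<in> L. s' = s} | s. s \<in> syms L}"

definition subsquare :: "('r, 'c, 's) entry set \<Rightarrow> ('r, 'c, 's) entry set \<Rightarrow> bool" where
  "subsquare M L \<longleftrightarrow> M \<subseteq> L \<and> latin_square M"

definition intersects :: "('r, 'c, 's) entry set \<Rightarrow> ('r, 'c, 's) entry set \<Rightarrow> bool" where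
  "intersects M l \<longleftrightarrow> (\<exists>e\<in>l. e \<in> M)"

text \<open>
  ``Smallest'' means with the fewest entries, not least for inclusion: over the empty set
  any single entry of \<open>l\<close> qualifies, so there is no least subsquare and no chain could
  satisfy the condition at its first step. For nonempty \<open>P\<close> the two readings coincide,
  see \<open>smallest_subsquare_iff_least\<close>.
\<close>

definition smallest_subsquare ::
  "('r, 'c, 's) entry set \<Rightarrow> ('r, 'c, 's) entry set \<Rightarrow> ('r, 'c, 's) entry set \<Rightarrow>
   ('r, 'c, 's) entry set \<Rightarrow> bool" where
  "smallest_subsquare L l P M \<longleftrightarrow>
     is_arg_min card (\<lambda>T. subsquare T L \<and> intersects T l \<and> P \<subseteq> T) M"

text \<open>A chain \<open>S 0, \<dots>, S \<alpha>\<close>; the values of \<open>S\<close> beyond \<open>\<alpha>\<close> are irrelevant.\<close>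

definition chain :: "('r, 'c, 's) entry set \<Rightarrow> (nat \<Rightarrow> ('r, 'c, 's) entry set) \<Rightarrow> nat \<Rightarrow> bool" where
  "chain L S \<alpha> \<longleftrightarrow>
     1 \<le> \<alpha> \<and> (\<forall>i\<le>\<alpha>. subsquare (S i) L) \<and> (\<forall>i<\<alpha>. S i \<subseteq> S (Suc i)) \<and>
     S 0 = {} \<and> (\<exists>e. S 1 = {e}) \<and> S \<alpha> = L"

definition connected_chain ::
  "('r, 'c, 's) entry set \<Rightarrow> (nat \<Rightarrow> ('r, 'c, 's) entry set) \<Rightarrow> nat \<Rightarrow> bool" where
  "connected_chain L S \<alpha> \<longleftrightarrow>
     chain L S \<alpha> \<and>
     (\<forall>i\<in>{1..\<alpha>}. \<exists>l\<in>lines L. intersects (S i) l \<and> \<not> intersects (S (i - 1)) l \<and>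
        smallest_subsquare L l (S (i - 1)) (S i))"

definition scc :: "('r, 'c, 's) entry set \<Rightarrow> nat" where
  "scc L = (LEAST \<alpha>. \<exists>S. connected_chain L S \<alpha>)"

lemma intercalate_example:
  "intercalate {(0::nat, 0::nat, 0::nat), (0, 1, 1), (1, 0, 1), (1, 1, 0)}"
  (is "intercalate ?I")
proof -
  have "rows ?I = {0, 1}" "cols ?I = {0, 1}" "syms ?I = {0, 1}"
    by (auto simp: rows_def cols_def syms_def)
  then show ?thesis
    by (auto simp: intercalate_def latin_square_of_order_def)
qed

lemma latin_square_iff:
  "latin_square L \<longleftrightarrow> finite L \<and>
     (\<forall>r\<in>rows L. \<forall>c\<in>cols L. \<exists>!s. (r, c, s) \<in> L) \<and>
     (\<forall>r\<in>rows L. \<forall>s\<in>syms L. \<exists>!c. (r, c, s) \<in> L) \<and>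
     (\<forall>c\<in>cols L. \<forall>s\<in>syms L. \<exists>!r. (r, c, s) \<in> L)"
  (is "_ \<longleftrightarrow> ?R")
proof
  show "latin_square L \<Longrightarrow> ?R"
    by (auto simp: latin_square_def latin_square_of_order_def)
next
  assume R: ?R
  then have R1: "\<And>r c. r \<in> rows L \<Longrightarrow> c \<in> cols L \<Longrightarrow> \<exists>!s. (r, c, s) \<in> L"
    and R2: "\<And>r s. r \<in> rows L \<Longrightarrow> s \<in> syms L \<Longrightarrow> \<exists>!c. (r, c, s) \<in> L"
    and R3: "\<And>c s. c \<in> cols L \<Longrightarrow> s \<in> syms L \<Longrightarrow> \<exists>!r. (r, c, s) \<in> L"
    by simp_all
  have cards: "card (rows L) = card (cols L) \<and> card (cols L) = card (syms L)"
  proof (cases "L = {}")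
    case True
    then show ?thesis by (simp add: rows_def cols_def syms_def)
  next
    case False
    then obtain r0 c0 s0 where e: "(r0, c0, s0) \<in> L" by auto
    then have m: "r0 \<in> rows L" "c0 \<in> cols L" "s0 \<in> syms L"
      by (auto simp: rows_def cols_def syms_def)
    define f where "f c = (THE s. (r0, c, s) \<in> L)" for c
    define g where "g r = (THE c. (r, c, s0) \<in> L)" for r
    have rcs: "r \<in> rows L" "c \<in> cols L" "s \<in> syms L" if "(r, c, s) \<in> L" for r c s
      using that by (auto simp: rows_def cols_def syms_def)
    have u1: "s = s'" if "(r, c, s) \<in> L" "(r, c, s') \<in> L" for r c s s'
      using that R1 rcs[OF that(1)] by blast
    have u2: "c = c'" if "(r, c, s) \<in> L" "(r, c', s) \<in> L" for r c c' s
      using that R2 rcs[OF that(1)] by blast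
    have u3: "r = r'" if "(r, c, s) \<in> L" "(r', c, s) \<in> L" for r r' c s
      using that R3 rcs[OF that(1)] by blast
    have f: "(r0, c, f c) \<in> L" if "c \<in> cols L" for c
      unfolding f_def by (rule theI'[OF R1[OF m(1) that]])
    have g: "(r, g r, s0) \<in> L" if "r \<in> rows L" for r
      unfolding g_def by (rule theI'[OF R2[OF that m(3)]])
    have "bij_betw f (cols L) (syms L)"
      unfolding bij_betw_def inj_on_def
    proof (intro conjI ballI impI set_eqI iffI)
      fix x y assume "x \<in> cols L" "y \<in> cols L" "f x = f y"
      then show "x = y" using f[of x] f[of y] u2 by simp
    next
      fix s assume "s \<in> f ` cols L" then show "s \<in> syms L" using f rcs(3) by blast
    next
      fix s assume "s \<in> syms L"
      then obtain c where "(r0, c, s) \<in> L" using R2[OF m(1)] by blast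
      then have "c \<in> cols L" "f c = s" using f[of c] rcs(2) u1 by blast+
      then show "s \<in> f ` cols L" by blast
    qed
    moreover have "bij_betw g (rows L) (cols L)"
      unfolding bij_betw_def inj_on_def
    proof (intro conjI ballI impI set_eqI iffI)
      fix x y assume "x \<in> rows L" "y \<in> rows L" "g x = g y"
      then show "x = y" using g[of x] g[of y] u3 by simp
    next
      fix c assume "c \<in> g ` rows L" then show "c \<in> cols L" using g rcs(2) by blast
    next
      fix c assume "c \<in> cols L"
      then obtain r where "(r, c, s0) \<in> L" using R3[OF _ m(3)] by blast
      then have "r \<in> rows L" "g r = c" using g[of r] rcs(1) u2 by blast+
      then show "c \<in> g ` rows L" by blast
    qed
    ultimately show ?thesis by (simp add: bij_betw_same_card)
  qed
  show "latin_square L"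
    unfolding latin_square_def latin_square_of_order_def
    by (rule exI[of _ "card (rows L)"]) (use R cards in simp)
qed

lemma latin_square_rules:
  assumes "latin_square L"
  shows "(r, c, s1) \<in> L \<Longrightarrow> (r1, c', s') \<in> L \<Longrightarrow> \<exists>!s. (r, c', s) \<in> L"
    and "(r, c, s1) \<in> L \<Longrightarrow> (r1, c', s') \<in> L \<Longrightarrow> \<exists>!c. (r, c, s') \<in> L"
    and "(r, c, s1) \<in> L \<Longrightarrow> (r1, c', s') \<in> L \<Longrightarrow> \<exists>!r. (r, c, s') \<in> L"
proof -
  have rcs: "r \<in> rows L" "c \<in> cols L" "s \<in> syms L" if "(r, c, s) \<in> L" for r c s
    using that by (auto simp: rows_def cols_def syms_def)
  note L = assms[unfolded latin_square_iff]
  show "(r, c, s1) \<in> L \<Longrightarrow> (r1, c', s') \<in> L \<Longrightarrow> \<exists>!s. (r, c', s) \<in> L"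
    by (rule L[THEN conjunct2, THEN conjunct1, rule_format, OF rcs(1) rcs(2)])
  show "(r, c, s1) \<in> L \<Longrightarrow> (r1, c', s') \<in> L \<Longrightarrow> \<exists>!c. (r, c, s') \<in> L"
    by (rule L[THEN conjunct2, THEN conjunct2, THEN conjunct1, rule_format, OF rcs(1) rcs(3)])
  show "(r, c, s1) \<in> L \<Longrightarrow> (r1, c', s') \<in> L \<Longrightarrow> \<exists>!r. (r, c, s') \<in> L"
    by (rule L[THEN conjunct2, THEN conjunct2, THEN conjunct2, rule_format, OF rcs(2) rcs(3)])
qed

lemma latin_square_unique:
  assumes "latin_square L"
  shows "(r, c, s) \<in> L \<Longrightarrow> (r, c, s') \<in> L \<Longrightarrow> s = s'"
    and "(r, c, s) \<in> L \<Longrightarrow> (r, c', s) \<in> L \<Longrightarrow> c = c'"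
    and "(r, c, s) \<in> L \<Longrightarrow> (r', c, s) \<in> L \<Longrightarrow> r = r'"
  using latin_square_rules[OF assms, of r c s r c s] by blast+

lemma latin_square_exists:
  assumes "latin_square L" "(r, c, s) \<in> L" "(r', c', s') \<in> L"
  shows "\<exists>x. (r, c', x) \<in> L" and "\<exists>x. (r, x, s') \<in> L" and "\<exists>x. (x, c, s') \<in> L"
  using latin_square_rules[OF assms] by blast+

lemma subsquare_Int:
  assumes L: "latin_square L" and M: "subsquare M L" and N: "subsquare N L"
  shows "subsquare (M \<inter> N) L"
proof -
  note MN = M[unfolded subsquare_def] N[unfolded subsquare_def]
  have fin: "finite (M \<inter> N)" using MN by (auto simp: latin_square_iff)
  have sub: "x \<in> L" if "x \<in> M \<or> x \<in> N" for x using that MN by blast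
  note uL = latin_square_unique[OF L]
  have ex: "(\<exists>x. (r, c', x) \<in> M \<inter> N) \<and> (\<exists>x. (r, x, s') \<in> M \<inter> N) \<and> (\<exists>x. (x, c, s') \<in> M \<inter> N)"
    if e: "(r, c, s) \<in> M \<inter> N" and e': "(r', c', s') \<in> M \<inter> N" for r c s r' c' s'
  proof -
    note eM = latin_square_exists[of M r c s r' c' s'] and eN = latin_square_exists[of N r c s r' c' s']
    obtain x y where "(r, c', x) \<in> M" "(r, c', y) \<in> N" using eM(1) eN(1) e e' MN by blast
    moreover then have "x = y" using uL(1) sub by blast
    moreover obtain z w where "(r, z, s') \<in> M" "(r, w, s') \<in> N" using eM(2) eN(2) e e' MN by blast
    moreover then have "z = w" using uL(2) sub by blast
    moreover obtain u v where "(u, c, s') \<in> M" "(v, c, s') \<in> N" using eM(3) eN(3) e e' MN by blast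
    moreover then have "u = v" using uL(3) sub by blast
    ultimately show ?thesis by blast
  qed
  have "latin_square (M \<inter> N)"
    unfolding latin_square_iff
  proof (intro conjI ballI)
    fix r c assume "r \<in> rows (M \<inter> N)" "c \<in> cols (M \<inter> N)"
    then have "\<exists>x. (r, c, x) \<in> M \<inter> N" unfolding rows_def cols_def using ex by blast
    then show "\<exists>!s. (r, c, s) \<in> M \<inter> N" using uL(1) sub by blast
  next
    fix r s assume "r \<in> rows (M \<inter> N)" "s \<in> syms (M \<inter> N)"
    then have "\<exists>x. (r, x, s) \<in> M \<inter> N" unfolding rows_def syms_def using ex by blast
    then show "\<exists>!c. (r, c, s) \<in> M \<inter> N" using uL(2) sub by blast
  next
    fix c s assume "c \<in> cols (M \<inter> N)" "s \<in> syms (M \<inter> N)"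
    then have "\<exists>x. (x, c, s) \<in> M \<inter> N" unfolding cols_def syms_def using ex by blast
    then show "\<exists>!r. (r, c, s) \<in> M \<inter> N" using uL(3) sub by blast
  qed (rule fin)
  then show ?thesis using MN unfolding subsquare_def by blast
qed

lemma intersects_Int:
  assumes L: "latin_square L" and l: "l \<in> lines L"
    and M: "subsquare M L" "intersects M l" and N: "subsquare N L" "intersects N l"
    and ne: "M \<inter> N \<noteq> {}"
  shows "intersects (M \<inter> N) l"
proof -
  obtain r0 c0 s0 where p: "(r0, c0, s0) \<in> M" "(r0, c0, s0) \<in> N" using ne by auto
  obtain r c s where m: "(r, c, s) \<in> M" "(r, c, s) \<in> l" using M(2) unfolding intersects_def by auto
  obtain r' c' s' where n: "(r', c', s') \<in> N" "(r', c', s') \<in> l" using N(2) unfolding intersects_def by auto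
  have LM: "latin_square M" "M \<subseteq> L" and LN: "latin_square N" "N \<subseteq> L"
    using M N by (auto simp: subsquare_def)
  note eM = latin_square_exists[OF LM(1) m(1) p(1)] latin_square_exists[OF LM(1) p(1) m(1)]
  note eN = latin_square_exists[OF LN(1) n(1) p(2)] latin_square_exists[OF LN(1) p(2) n(1)]
  note uL = latin_square_unique[OF L]
  consider (r) "l = {(r', c, s) \<in> L. r' = r}" "r' = r"
    | (c) "l = {(r, c', s) \<in> L. c' = c}" "c' = c"
    | (s) "l = {(r, c, s') \<in> L. s' = s}" "s' = s"
    using l m(2) n(2) unfolding lines_def by auto
  then show ?thesis
  proof cases
    case r
    obtain x y where xy: "(r, c0, x) \<in> M" "(r, c0, y) \<in> N" using eM(1) eN(1) r by blast
    then have "x = y" using uL(1) LM LN by blast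
    then show ?thesis using xy LM r unfolding intersects_def by blast
  next
    case c
    obtain x y where xy: "(r0, c, x) \<in> M" "(r0, c, y) \<in> N" using eM(4) eN(4) c by blast
    then have "x = y" using uL(1) LM LN by blast
    then show ?thesis using xy LM c unfolding intersects_def by blast
  next
    case s
    obtain x y where xy: "(r0, x, s) \<in> M" "(r0, y, s) \<in> N" using eM(5) eN(5) s by blast
    then have "x = y" using uL(2) LM LN by blast
    then show ?thesis using xy LM s unfolding intersects_def by blast
  qed
qed

lemma smallest_subsquare_iff_least:
  assumes L: "latin_square L" and l: "l \<in> lines L" and P: "P \<noteq> {}"
  shows "smallest_subsquare L l P M \<longleftrightarrow>
    subsquare M L \<and> intersects M l \<and> P \<subseteq> M \<and>
    (\<forall>T. subsquare T L \<and> intersects T l \<and> P \<subseteq> T \<longrightarrow> M \<subseteq> T)"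
proof -
  have fin: "finite T" if "subsquare T L" for T
    using that by (auto simp: subsquare_def latin_square_iff)
  have "M \<subseteq> T" if M: "subsquare M L" "intersects M l" "P \<subseteq> M"
    and T: "subsquare T L" "intersects T l" "P \<subseteq> T"
    and min: "\<And>U. subsquare U L \<and> intersects U l \<and> P \<subseteq> U \<Longrightarrow> card M \<le> card U" for T
  proof -
    have "M \<inter> T \<noteq> {}" using M T P by blast
    then have "card M \<le> card (M \<inter> T)"
      using min subsquare_Int[OF L M(1) T(1)] intersects_Int[OF L l M(1,2) T(1,2)] M T by blast
    then have "M \<inter> T = M" using card_seteq[of M "M \<inter> T"] fin[OF M(1)] by blast
    then show ?thesis by blast
  qed
  then show ?thesis
    unfolding smallest_subsquare_def is_arg_min_linorder by (meson card_mono fin)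
qed

end

theory Submission
  imports Defs "HOL-Library.Function_Algebras" "HOL-Library.Z2"
begin

text \<open>
  The coordinates of an intercalate in the two-element group identify \<open>I\<^sup>k\<close> with the Cayley
  table of an elementary abelian 2-group. A nonempty subsquare of such a table consists of cosets
  of a subgroup \<open>H\<close>, and joining a further coset of \<open>H\<close> produces a subsquare of twice the order that
  meets any prescribed line. On the other hand, in every Latin square a proper subsquare has
  at most half the order. So each step of a connected chain multiplies the number of entries by
  at most 4, and every step along a missed line multiplies it by exactly 4, up to \<open>4\<^sup>k\<close>.
\<close>

section \<open>Entries, orders and proper subsquares of Latin squares\<close>

lemma rows_cols_syms_memI:
  assumes "(r, c, s) \<in> L"
  shows "r \<in> rows L" "c \<in> cols L" "s \<in> syms L"
  using assms by (auto simp: rows_def cols_def syms_def)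

text \<open>Existence and uniqueness are separated and stated for entries instead of for
  \<open>rows\<close>, \<open>cols\<close> and \<open>syms\<close>. By
  \<open>latin_square_iff\<close> the common order then comes for free.\<close>

lemma latin_squareI:
  assumes "finite L"
    and "\<And>r c s s'. (r, c, s) \<in> L \<Longrightarrow> (r, c, s') \<in> L \<Longrightarrow> s = s'"
    and "\<And>r c c' s. (r, c, s) \<in> L \<Longrightarrow> (r, c', s) \<in> L \<Longrightarrow> c = c'"
    and "\<And>r r' c s. (r, c, s) \<in> L \<Longrightarrow> (r', c, s) \<in> L \<Longrightarrow> r = r'"
    and "\<And>r c s r' c' s'. (r, c, s) \<in> L \<Longrightarrow> (r', c', s') \<in> L \<Longrightarrow> \<exists>x. (r, c', x) \<in> L"
    and "\<And>r c s r' c' s'. (r, c, s) \<in> L \<Longrightarrow> (r', c', s') \<in> L \<Longrightarrow> \<exists>x. (r, x, s') \<in> L"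
    and "\<And>r c s r' c' s'. (r, c, s) \<in> L \<Longrightarrow> (r', c', s') \<in> L \<Longrightarrow> \<exists>x. (x, c, s') \<in> L"
  shows "latin_square L"
  unfolding latin_square_iff
proof (intro conjI ballI)
  show "finite L" by fact
  fix r c assume "r \<in> rows L" "c \<in> cols L"
  then have "\<exists>x. (r, c, x) \<in> L" unfolding rows_def cols_def using assms(5) by blast
  then show "\<exists>!s. (r, c, s) \<in> L" using assms(2) by blast
next
  fix r s assume "r \<in> rows L" "s \<in> syms L"
  then have "\<exists>x. (r, x, s) \<in> L" unfolding rows_def syms_def using assms(6) by blast
  then show "\<exists>!c. (r, c, s) \<in> L" using assms(3) by blast
next
  fix c s assume "c \<in> cols L" "s \<in> syms L"
  then have "\<exists>x. (x, c, s) \<in> L" unfolding cols_def syms_def using assms(7) by blast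
  then show "\<exists>!r. (r, c, s) \<in> L" using assms(4) by blast
qed

lemma finite_rows: "finite L \<Longrightarrow> finite (rows L)"
  by (rule finite_subset[of _ "fst ` L"]) (force simp: rows_def)+

lemma finite_cols: "finite L \<Longrightarrow> finite (cols L)"
  by (rule finite_subset[of _ "(fst \<circ> snd) ` L"]) (force simp: cols_def)+

lemma finite_syms: "finite L \<Longrightarrow> finite (syms L)"
  by (rule finite_subset[of _ "(snd \<circ> snd) ` L"]) (force simp: syms_def)+

lemma latin_square_same_order:
  assumes "latin_square L"
  shows "card (cols L) = card (rows L)" "card (syms L) = card (rows L)"
  using assms by (auto simp: latin_square_def latin_square_of_order_def)

text \<open>Forgetting the symbol is a bijection onto the cells, so bounds on orders and on numbers
  of entries can be exchanged.\<close>

lemma card_latin_square: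
  assumes L: "latin_square L"
  shows "card L = card (rows L) ^ 2"
proof -
  have "bij_betw (\<lambda>(r, c, s). (r, c)) L (rows L \<times> cols L)"
    unfolding bij_betw_def
  proof
    show "inj_on (\<lambda>(r, c, s). (r, c)) L"
      using latin_square_unique(1)[OF L] by (auto simp: inj_on_def)
    show "(\<lambda>(r, c, s). (r, c)) ` L = rows L \<times> cols L"
    proof
      show "(\<lambda>(r, c, s). (r, c)) ` L \<subseteq> rows L \<times> cols L"
        by (auto simp: rows_def cols_def)
      show "rows L \<times> cols L \<subseteq> (\<lambda>(r, c, s). (r, c)) ` L"
      proof clarify
        fix r c assume "r \<in> rows L" "c \<in> cols L"
        then obtain s where "(r, c, s) \<in> L"
          unfolding rows_def cols_def using latin_square_exists(1)[OF L] by blast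
        then show "(r, c) \<in> (\<lambda>(r, c, s). (r, c)) ` L" by force
      qed
    qed
  qed
  then show ?thesis
    by (simp add: bij_betw_same_card card_cartesian_product latin_square_same_order[OF L]
        power2_eq_square)
qed

text \<open>A missed row brings as many new symbols as \<open>P\<close> has columns. The order at
  least doubles, and the number of entries is its square.\<close>

lemma card_proper_subsquare:
  assumes M: "latin_square M" and P: "subsquare P M" and r: "r \<in> rows M" "r \<notin> rows P"
  shows "4 * card P \<le> card M"
proof -
  have PM: "P \<subseteq> M" "latin_square P" using P by (auto simp: subsquare_def)
  have fin: "finite M" using M by (simp add: latin_square_iff)
  note finP = finite_subset[OF PM(1) fin]
  \<comment> \<open>In row \<open>r\<close>, the columns of \<open>P\<close> carry symbols that do not occur in \<open>P\<close>.\<close>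
  have "\<forall>c\<in>cols P. \<exists>s. (r, c, s) \<in> M"
  proof
    fix c assume "c \<in> cols P"
    then show "\<exists>s. (r, c, s) \<in> M"
      using r(1) PM(1) latin_square_exists(1)[OF M] unfolding rows_def cols_def by blast
  qed
  then obtain t where t: "\<And>c. c \<in> cols P \<Longrightarrow> (r, c, t c) \<in> M" by metis
  have "inj_on t (cols P)"
    by (metis inj_onI t latin_square_unique(2)[OF M])
  then have "card (t ` cols P) = card (rows P)"
    by (simp add: card_image latin_square_same_order[OF PM(2)])
  \<comment> \<open>A symbol \<open>t c\<close> of \<open>P\<close> would also occur in column
    \<open>c\<close> within \<open>P\<close>. Uniqueness in \<open>M\<close> puts that occurrence in
    row \<open>r\<close>, which \<open>P\<close> misses.\<close>
  moreover have "t ` cols P \<inter> syms P = {}"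
  proof -
    have False if c: "c \<in> cols P" and tc: "t c \<in> syms P" for c
    proof -
      obtain r' where "(r', c, t c) \<in> P"
        using c tc latin_square_exists(3)[OF PM(2)] unfolding cols_def syms_def by blast
      moreover from this have "r' = r"
        using t[OF c] PM(1) latin_square_unique(3)[OF M] by blast
      ultimately show False using r(2) rows_cols_syms_memI by metis
    qed
    then show ?thesis by blast
  qed
  moreover have "t ` cols P \<union> syms P \<subseteq> syms M"
    using t PM(1) unfolding syms_def by blast
  ultimately have "card (rows P) + card (rows P) \<le> card (rows M)"
    using card_mono[OF finite_syms[OF fin], of "t ` cols P \<union> syms P"]
    by (simp add: card_Un_disjoint finite_cols finite_syms finP
        latin_square_same_order[OF PM(2)] latin_square_same_order[OF M])
  then have "(2 * card (rows P)) ^ 2 \<le> card (rows M) ^ 2"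
    by (intro power_mono) auto
  then show ?thesis
    by (simp add: card_latin_square M PM(2) power_mult_distrib)
qed

section \<open>Doubling subsquares in elementary abelian 2-groups\<close>

text \<open>The maps \<open>f\<close>, \<open>g\<close>, \<open>h\<close> place \<open>L\<close>
  inside a Cayley table. A translate of \<open>P\<close> has a subgroup \<open>H\<close> as its
  coordinates; adjoining one element \<open>d\<close> that reaches \<open>l\<close> gives a subgroup
  \<open>K\<close> with at most twice as many elements, and \<open>T\<close> is the part of
  \<open>L\<close> with coordinates in \<open>K\<close>.\<close>

lemma subsquare_double:
  fixes L :: "('r, 'c, 's) entry set"
    and f :: "'r \<Rightarrow> 'g::ab_group_add" and g :: "'c \<Rightarrow> 'g" and h :: "'s \<Rightarrow> 'g"
  assumes L: "latin_square L"
    and char2: "\<And>x::'g. x + x = 0"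
    and hom: "\<And>r c s. (r, c, s) \<in> L \<Longrightarrow> f r + g c = h s"
    and inj: "inj_on f (rows L)"
    and P: "subsquare P L" "P \<noteq> {}" and l: "l \<in> lines L"
  obtains T where "subsquare T L" "intersects T l" "P \<subseteq> T" "card T \<le> 4 * card P"
proof -
  have PL: "P \<subseteq> L" "latin_square P" using P by (auto simp: subsquare_def)
  have fin: "finite L" using L by (simp add: latin_square_iff)
  note finP = finite_subset[OF PL(1) fin]
  obtain r0 c0 s0 where e: "(r0, c0, s0) \<in> P" using P(2) by auto
  \<comment> \<open>Adding \<open>a\<close>, \<open>b\<close> and \<open>a + b\<close> to the
    coordinates of rows, columns and symbols moves the chosen entry to the origin, since every
    element is its own inverse.\<close>
  define a where "a = f r0"
  define b where "b = g c0"
  have s0: "h s0 = a + b" using hom e PL a_def b_def by fastforce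
  have cancel: "x + (x + y) = y" for x y :: 'g
    by (simp add: char2 flip: add.assoc)
  \<comment> \<open>AC rewriting together with both forms of cancellation normalises sums in a group
    of exponent 2.\<close>
  note norm = cancel char2 add.assoc add.commute add.left_commute
  define H where "H = (\<lambda>r. f r + a) ` rows P"
  \<comment> \<open>Rows, columns and symbols share the same \<open>H\<close>: a column is traded
    for a row through symbol \<open>s0\<close>, a symbol through column \<open>c0\<close>.\<close>
  have HP: "f r + a \<in> H" "g c + b \<in> H" "h s + (a + b) \<in> H" if p: "(r, c, s) \<in> P" for r c s
  proof -
    show "f r + a \<in> H" using rows_cols_syms_memI[OF p] by (simp add: H_def)
    obtain r' where r': "(r', c, s0) \<in> P" using latin_square_exists(3)[OF PL(2) p e] by blast
    then have "f r' + g c = a + b" using hom PL s0 by force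
    then have "g c = f r' + (a + b)" by (metis cancel)
    then have "g c + b = f r' + a" by (simp add: norm)
    then show "g c + b \<in> H" using rows_cols_syms_memI[OF r'] by (simp add: H_def)
    obtain r'' where r'': "(r'', c0, s) \<in> P" using latin_square_exists(3)[OF PL(2) e p] by blast
    then have "h s = f r'' + b" using hom PL b_def by force
    then have "h s + (a + b) = f r'' + a"
      by (simp add: norm)
    then show "h s + (a + b) \<in> H" using rows_cols_syms_memI[OF r''] by (simp add: H_def)
  qed
  have H0: "0 \<in> H" using HP(1)[OF e] by (simp add: a_def char2)
  have Hadd: "x + y \<in> H" if "x \<in> H" "y \<in> H" for x y
  proof -
    obtain r c s where p: "(r, c, s) \<in> P" and x: "x = f r + a"
      using \<open>x \<in> H\<close> by (auto simp: H_def rows_def)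
    obtain r' c' s' where p': "(r', c', s') \<in> P" and y: "y = f r' + a"
      using \<open>y \<in> H\<close> by (auto simp: H_def rows_def)
    \<comment> \<open>Column \<open>c1\<close> is chosen to have the translated coordinate
      \<open>y\<close>. The entry of row \<open>r\<close> in it then has a symbol with coordinate
      \<open>x + y\<close>.\<close>
    obtain c1 where c1: "(r', c1, s0) \<in> P" using latin_square_exists(2)[OF PL(2) p' e] by blast
    obtain s1 where s1: "(r, c1, s1) \<in> P" using latin_square_exists(1)[OF PL(2) p c1] by blast
    have 1: "f r' + g c1 = a + b" using hom c1 PL s0 by force
    have 2: "f r + g c1 = h s1" using hom s1 PL by blast
    have "h s1 + (a + b) = (f r + g c1) + (f r' + g c1)" by (simp only: 1 2)
    also have "\<dots> = f r + f r'" by (simp add: norm)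
    also have "\<dots> = x + y" by (simp add: x y norm)
    finally show ?thesis using HP(3)[OF s1] by simp
  qed
  \<comment> \<open>Every line has an entry in row \<open>r0\<close> or column \<open>c0\<close>.
    One of its translated coordinates is 0, so the other two agree; \<open>d\<close> is their common
    value.\<close>
  have lcases: "\<exists>r c s d. (r, c, s) \<in> L \<and> (r, c, s) \<in> l \<and>
      f r + a \<in> {0, d} \<and> g c + b \<in> {0, d} \<and> h s + (a + b) \<in> {0, d}"
  proof -
    have eL: "(r0, c0, s0) \<in> L" using e PL by blast
    have third: "h s + (a + b) = (f r + a) + (g c + b)" if "(r, c, s) \<in> L" for r c s
      using hom[OF that, symmetric] by (simp add: norm)
    consider (r) r c s where "l = {(r', c, s) \<in> L. r' = r}" "(r, c, s) \<in> L"
      | (c) r c s where "l = {(r, c', s) \<in> L. c' = c}" "(r, c, s) \<in> L"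
      | (s) r c s where "l = {(r, c, s') \<in> L. s' = s}" "(r, c, s) \<in> L"
      using l unfolding lines_def rows_def cols_def syms_def by blast
    then show ?thesis
    proof cases
      case r
      then obtain x where x: "(r, c0, x) \<in> L" using latin_square_exists(1)[OF L _ eL] by blast
      then have "h x + (a + b) = f r + a" using third[OF x] by (simp add: b_def char2)
      then show ?thesis using x r by (intro exI[of _ r] exI[of _ c0] exI[of _ x] exI[of _ "f r + a"])
          (simp add: b_def char2)
    next
      case c
      then obtain x where x: "(r0, c, x) \<in> L" using latin_square_exists(1)[OF L eL] by blast
      then have "h x + (a + b) = g c + b" using third[OF x] by (simp add: a_def char2)
      then show ?thesis using x c by (intro exI[of _ r0] exI[of _ c] exI[of _ x] exI[of _ "g c + b"])
          (simp add: a_def char2)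
    next
      case s
      then obtain x where x: "(r0, x, s) \<in> L" using latin_square_exists(2)[OF L eL] by blast
      then have "h s + (a + b) = g x + b" using third[OF x] by (simp add: a_def char2)
      then show ?thesis using x s by (intro exI[of _ r0] exI[of _ x] exI[of _ s] exI[of _ "g x + b"])
          (simp add: a_def char2)
    qed
  qed
  then obtain r1 c1 s1 d where q: "(r1, c1, s1) \<in> L" "(r1, c1, s1) \<in> l"
    "f r1 + a \<in> {0, d}" "g c1 + b \<in> {0, d}" "h s1 + (a + b) \<in> {0, d}"
    by blast
  \<comment> \<open>The subgroup generated by \<open>H\<close> and \<open>d\<close>: two cosets
    suffice because \<open>d + d = 0\<close>. If \<open>d\<close> lies in \<open>H\<close>, then
    \<open>K\<close> is \<open>H\<close>.\<close>
  define K where "K = H \<union> (+) d ` H"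
  have HK: "H \<subseteq> K" by (simp add: K_def)
  have "d \<in> K" using H0 by (force simp: K_def)
  then have K0d: "{0, d} \<subseteq> K" using H0 HK by blast
  have Kadd: "x + y \<in> K" if "x \<in> K" "y \<in> K" for x y
  proof -
    have 1: "d + u + v \<in> K" "u + (d + v) \<in> K" "d + u + (d + v) \<in> K" if "u \<in> H" "v \<in> H" for u v
    proof -
      note uv = Hadd[OF that]
      have "d + u + v = d + (u + v)" "u + (d + v) = d + (u + v)" by (simp_all add: norm)
      then show "d + u + v \<in> K" "u + (d + v) \<in> K" using uv by (simp_all add: K_def)
      have "d + u + (d + v) = u + v" by (simp add: norm)
      then show "d + u + (d + v) \<in> K" using uv HK by (metis subsetD)
    qed
    have "x \<in> H \<or> (\<exists>u\<in>H. x = d + u)" "y \<in> H \<or> (\<exists>v\<in>H. y = d + v)"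
      using that by (auto simp: K_def)
    then show ?thesis using 1 Hadd HK by (elim disjE bexE) auto
  qed
  define T where
    "T = {(r, c, s). (r, c, s) \<in> L \<and> f r + a \<in> K \<and> g c + b \<in> K \<and> h s + (a + b) \<in> K}"
  have TL: "T \<subseteq> L" by (auto simp: T_def)
  \<comment> \<open>Each translated coordinate is the sum of the other two, so two of them in
    \<open>K\<close> force the third. This makes \<open>T\<close> closed under completing
    entries.\<close>
  have in_T: "(r, c, s) \<in> T" if rcs: "(r, c, s) \<in> L" and
      "f r + a \<in> K \<and> g c + b \<in> K \<or> f r + a \<in> K \<and> h s + (a + b) \<in> K \<or>
       g c + b \<in> K \<and> h s + (a + b) \<in> K" for r c s
  proof -
    have "h s + (a + b) = (f r + a) + (g c + b)" "f r + a = (g c + b) + (h s + (a + b))"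
      "g c + b = (f r + a) + (h s + (a + b))"
      using hom[OF rcs, symmetric] by (simp_all add: norm)
    then show ?thesis using that Kadd unfolding T_def
      by (smt (verit) case_prodI mem_Collect_eq)
  qed
  note uL = latin_square_unique[OF L] and eL = latin_square_exists[OF L]
  have latT: "latin_square T"
  proof (rule latin_squareI)
    show "finite T" using TL fin by (rule finite_subset)
    fix r c s r' c' s'
    assume p: "(r, c, s) \<in> T" "(r', c', s') \<in> T"
    then have pL: "(r, c, s) \<in> L" "(r', c', s') \<in> L" using TL by blast+
    note K = p[unfolded T_def]
    show "\<exists>x. (r, c', x) \<in> T" using eL(1)[OF pL] K in_T by blast
    show "\<exists>x. (r, x, s') \<in> T" using eL(2)[OF pL] K in_T by blast
    show "\<exists>x. (x, c, s') \<in> T" using eL(3)[OF pL] K in_T by blast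
  qed (use TL uL in blast)+
  \<comment> \<open>Injectivity of \<open>f\<close> embeds the rows of \<open>T\<close> into
    \<open>K\<close>, which bounds the order of \<open>T\<close> by twice that of
    \<open>P\<close>.\<close>
  have "card (rows T) = card ((\<lambda>r. f r + a) ` rows T)"
  proof (rule card_image[symmetric])
    have "rows T \<subseteq> rows L" using TL by (auto simp: rows_def)
    then show "inj_on (\<lambda>r. f r + a) (rows T)"
      using inj by (auto simp: inj_on_def)
  qed
  also have "\<dots> \<le> card K"
  proof (rule card_mono)
    show "finite K" by (simp add: K_def H_def finite_rows finP)
    show "(\<lambda>r. f r + a) ` rows T \<subseteq> K" by (auto simp: T_def rows_def)
  qed
  also have "\<dots> \<le> card H + card H"
    unfolding K_def by (rule order.trans[OF card_Un_le])
      (simp add: card_image_le H_def finite_rows finP)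
  also have "\<dots> \<le> 2 * card (rows P)"
    using card_image_le[OF finite_rows[OF finP]] by (auto simp: H_def mult_2 intro: add_mono)
  finally have "card (rows T) ^ 2 \<le> (2 * card (rows P)) ^ 2" by (rule power_mono) simp
  then have "card T \<le> 4 * card P"
    by (simp add: card_latin_square latT PL(2) power_mult_distrib)
  moreover have "P \<subseteq> T"
    using PL(1) HP HK unfolding T_def by blast
  moreover have "intersects T l"
    using q K0d unfolding intersects_def T_def by blast
  ultimately show thesis using that latT TL unfolding subsquare_def by blast
qed

section \<open>Coordinates of an intercalate, and powers of Latin squares\<close>

text \<open>Any entry can serve as origin: its row, column and symbol get coordinate 0, the others
  1. With only two symbols, the Latin property leaves addition modulo 2.\<close>

lemma intercalate_coordinates:
  assumes "intercalate I"
  obtains f :: "'r \<Rightarrow> bit" and g :: "'c \<Rightarrow> bit" and h :: "'s \<Rightarrow> bit" where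
    "\<And>r c s. (r, c, s) \<in> I \<Longrightarrow> f r + g c = h s" "inj_on f (rows I)"
proof -
  have I: "latin_square I" and two: "card (rows I) = 2" "card (syms I) = 2"
    using assms by (auto simp: intercalate_def latin_square_def latin_square_of_order_def)
  have pair: "x = y \<or> y = z \<or> x = z" if "card A = 2" "x \<in> A" "y \<in> A" "z \<in> A" for x y z :: 'x and A
    using that by (auto simp: card_2_iff)
  have "rows I \<noteq> {}" using two(1) by auto
  then obtain r0 c0 s0 where e: "(r0, c0, s0) \<in> I" by (auto simp: rows_def)
  define f :: "'r \<Rightarrow> bit" where "f r = of_bool (r \<noteq> r0)" for r
  define g :: "'c \<Rightarrow> bit" where "g c = of_bool (c \<noteq> c0)" for c
  define h :: "'s \<Rightarrow> bit" where "h s = of_bool (s \<noteq> s0)" for s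
  note u = latin_square_unique[OF I]
  have "f r + g c = h s" if p: "(r, c, s) \<in> I" for r c s
  proof -
    have "s = s0" if "r \<noteq> r0" "c \<noteq> c0"
    proof -
      obtain s' where s': "(r0, c, s') \<in> I" using latin_square_exists(1)[OF I e p] by blast
      then have "s' \<noteq> s0" "s' \<noteq> s" using u e p that by blast+
      then show ?thesis
        using pair[OF two(2)] s' p e rows_cols_syms_memI by metis
    qed
    moreover have "s = s0 \<longleftrightarrow> c = c0" if "r = r0" using u e p that by blast
    moreover have "s = s0 \<longleftrightarrow> r = r0" if "c = c0" using u e p that by blast
    ultimately show ?thesis by (auto simp: f_def g_def h_def)
  qed
  moreover have "inj_on f (rows I)"
    using pair[OF two(1) _ _ rows_cols_syms_memI(1)[OF e]]
    by (auto simp: inj_on_def f_def)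
  ultimately show thesis using that by blast
qed

text \<open>The single entry with empty labels at exponent 0 makes one recursion cover both
  successor equations, so inductions can start at 0.\<close>

lemma latin_power_Suc:
  "latin_power L (Suc k) =
    {(r1 @ [r2], c1 @ [c2], s1 @ [s2]) | r1 r2 c1 c2 s1 s2.
      (r1, c1, s1) \<in> latin_power L k \<and> (r2, c2, s2) \<in> L}"
  by (cases k) (auto simp: latin_prod_def)

lemma latin_power_nth:
  assumes "(rs, cs, ss) \<in> latin_power L k"
  shows "length rs = k \<and> length cs = k \<and> length ss = k \<and>
    (\<forall>i<k. (rs ! i, cs ! i, ss ! i) \<in> L)"
  using assms
proof (induction k arbitrary: rs cs ss)
  case (Suc k)
  then show ?case
    unfolding latin_power_Suc by (fastforce simp: nth_append less_Suc_eq)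
qed simp

lemma latin_square_latin_power:
  assumes L: "latin_square L"
  shows "latin_square (latin_power L k)"
proof (induction k)
  case 0
  show ?case by (rule latin_squareI) auto
next
  case (Suc k)
  note u = latin_square_unique[OF L] latin_square_unique[OF Suc]
  note e = latin_square_exists[OF L] latin_square_exists[OF Suc]
  have fin: "finite L" "finite (latin_power L k)" using L Suc by (auto simp: latin_square_iff)
  show ?case unfolding latin_power_Suc
  \<comment> \<open>Cases 5 to 7 are the existence conditions, solved by appending a solution in
    \<open>L\<close> to one in the smaller power. The uniqueness cases are left to
    \<open>u\<close>.\<close>
  proof (rule latin_squareI, goal_cases)
    case 1
    show ?case
      by (rule finite_subset[OF _ finite_imageI[OF finite_cartesian_product[OF fin(2,1)],
              of "\<lambda>((r1, c1, s1), (r2, c2, s2)). (r1 @ [r2], c1 @ [c2], s1 @ [s2])"]]) force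
  next
    case (5 r c s r' c' s')
    then obtain r1 r2 c1 c2 s1 s2 r1' r2' c1' c2' s1' s2' where
      1: "(r1, c1, s1) \<in> latin_power L k" "(r1', c1', s1') \<in> latin_power L k" and
      2: "(r2, c2, s2) \<in> L" "(r2', c2', s2') \<in> L" and
      eq: "r = r1 @ [r2]" "c = c1 @ [c2]" "s = s1 @ [s2]" "r' = r1' @ [r2']" "c' = c1' @ [c2']"
        "s' = s1' @ [s2']"
      by auto
    obtain x y where "(r1, c1', x) \<in> latin_power L k" "(r2, c2', y) \<in> L"
      using e(4)[OF 1] e(1)[OF 2] by blast
    then show ?case unfolding eq by (intro exI[of _ "x @ [y]"]) simp
  next
    case (6 r c s r' c' s')
    then obtain r1 r2 c1 c2 s1 s2 r1' r2' c1' c2' s1' s2' where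
      1: "(r1, c1, s1) \<in> latin_power L k" "(r1', c1', s1') \<in> latin_power L k" and
      2: "(r2, c2, s2) \<in> L" "(r2', c2', s2') \<in> L" and
      eq: "r = r1 @ [r2]" "c = c1 @ [c2]" "s = s1 @ [s2]" "r' = r1' @ [r2']" "c' = c1' @ [c2']"
        "s' = s1' @ [s2']"
      by auto
    obtain x y where "(r1, x, s1') \<in> latin_power L k" "(r2, y, s2') \<in> L"
      using e(5)[OF 1] e(2)[OF 2] by blast
    then show ?case unfolding eq by (intro exI[of _ "x @ [y]"]) simp
  next
    case (7 r c s r' c' s')
    then obtain r1 r2 c1 c2 s1 s2 r1' r2' c1' c2' s1' s2' where
      1: "(r1, c1, s1) \<in> latin_power L k" "(r1', c1', s1') \<in> latin_power L k" and
      2: "(r2, c2, s2) \<in> L" "(r2', c2', s2') \<in> L" and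
      eq: "r = r1 @ [r2]" "c = c1 @ [c2]" "s = s1 @ [s2]" "r' = r1' @ [r2']" "c' = c1' @ [c2']"
        "s' = s1' @ [s2']"
      by auto
    obtain x y where "(x, c1, s1') \<in> latin_power L k" "(y, c2, s2') \<in> L"
      using e(6)[OF 1] e(3)[OF 2] by blast
    then show ?case unfolding eq by (intro exI[of _ "x @ [y]"]) simp
  qed (use u in auto)
qed

lemma card_latin_power: "card (latin_power L k) = card L ^ k"
proof (induction k)
  case (Suc k)
  let ?j = "\<lambda>((r1, c1, s1), (r2, c2, s2)). (r1 @ [r2], c1 @ [c2], s1 @ [s2])"
  have "latin_power L (Suc k) = ?j ` (latin_power L k \<times> L)"
    unfolding latin_power_Suc by force
  moreover have "inj_on ?j (latin_power L k \<times> L)" by (auto simp: inj_on_def)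
  ultimately show ?case by (simp add: card_image card_cartesian_product Suc)
qed simp

text \<open>\<open>L\<close> itself is a candidate, and a minimum of \<open>card\<close> is attained
  among natural numbers.\<close>

lemma smallest_subsquare_exists:
  assumes "latin_square L" "l \<in> lines L" "P \<subseteq> L"
  obtains M where "smallest_subsquare L l P M"
proof -
  have "intersects L l"
    using assms(2) unfolding lines_def intersects_def rows_def cols_def syms_def by blast
  then have "subsquare L L \<and> intersects L l \<and> P \<subseteq> L"
    using assms by (simp add: subsquare_def)
  then show thesis
    using that ex_has_least_nat[of "\<lambda>T. subsquare T L \<and> intersects T l \<and> P \<subseteq> T" L card]
    unfolding smallest_subsquare_def is_arg_min_linorder by blast
qed

section \<open>Connected chains in powers of the intercalate\<close>

theorem theorem2p14:
  fixes I :: "('r, 'c, 's) entry set" and k :: nat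
  assumes "intercalate I" and "k \<ge> 1"
  shows "scc (latin_power I k) = k + 1"
proof -
  define L where "L = latin_power I k"
  have I: "latin_square I" "card I = 4"
  proof -
    show "latin_square I" using assms(1) by (auto simp: intercalate_def latin_square_def)
    then show "card I = 4"
      using assms(1) by (simp add: card_latin_square intercalate_def latin_square_of_order_def)
  qed
  have L: "latin_square L" and cardL: "card L = 4 ^ k"
    by (simp_all add: L_def latin_square_latin_power card_latin_power I)
  have finL: "finite L" using L by (simp add: latin_square_iff)
  obtain f :: "'r \<Rightarrow> bit" and g :: "'c \<Rightarrow> bit" and h :: "'s \<Rightarrow> bit" where
    hom: "\<And>r c s. (r, c, s) \<in> I \<Longrightarrow> f r + g c = h s" and inj: "inj_on f (rows I)"
    using intercalate_coordinates[OF assms(1)] by blast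
  \<comment> \<open>Positions from \<open>k\<close> on are filled with 0, so that the group is
    \<open>nat \<Rightarrow> bit\<close> with pointwise addition for every \<open>k\<close>.\<close>
  define F where "F rs = (\<lambda>i. if i < k then f (rs ! i) else 0)" for rs
  define G where "G cs = (\<lambda>i. if i < k then g (cs ! i) else 0)" for cs
  define H where "H ss = (\<lambda>i. if i < k then h (ss ! i) else 0)" for ss
  have homL: "F rs + G cs = H ss" if "(rs, cs, ss) \<in> L" for rs cs ss
    using latin_power_nth[OF that[unfolded L_def]] hom by (auto simp: F_def G_def H_def fun_eq_iff)
  have injL: "inj_on F (rows L)"
  proof (rule inj_onI)
    fix rs rs' assume rs: "rs \<in> rows L" "rs' \<in> rows L" and eq: "F rs = F rs'"
    have m: "length rs = k \<and> (\<forall>i<k. rs ! i \<in> rows I)" if "rs \<in> rows L" for rs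
    proof -
      obtain cs ss where "(rs, cs, ss) \<in> latin_power I k"
        using \<open>rs \<in> rows L\<close> by (auto simp: L_def rows_def)
      then show ?thesis using latin_power_nth rows_cols_syms_memI(1) by metis
    qed
    have "f (rs ! i) = f (rs' ! i)" if "i < k" for i
      using fun_cong[OF eq, of i] that by (simp add: F_def)
    then show "rs = rs'"
      using m[OF rs(1)] m[OF rs(2)] inj by (auto intro!: nth_equalityI dest: inj_onD)
  qed
  have char2: "x + x = 0" for x :: "nat \<Rightarrow> bit" by (simp add: fun_eq_iff)
  have grow: "card M \<le> 4 * card P"
    if "smallest_subsquare L l P M" "subsquare P L" "P \<noteq> {}" "l \<in> lines L" for l P M
  proof -
    obtain T where "subsquare T L" "intersects T l" "P \<subseteq> T" "card T \<le> 4 * card P"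
      using subsquare_double[where f = F and g = G and h = H, OF L char2 homL injL \<open>subsquare P L\<close> \<open>P \<noteq> {}\<close> \<open>l \<in> lines L\<close>] by blast
    moreover from this have "card M \<le> card T"
      using that(1) unfolding smallest_subsquare_def is_arg_min_linorder by blast
    ultimately show ?thesis by linarith
  qed
  have lower: "k + 1 \<le> \<alpha>" if "connected_chain L S \<alpha>" for S \<alpha>
  proof -
    note cc = that[unfolded connected_chain_def chain_def]
    \<comment> \<open>The exponent lags by one because \<open>S 1\<close> is already a single entry.
      Nonemptiness is carried along since \<open>grow\<close> requires it.\<close>
    have "Suc i \<le> \<alpha> \<longrightarrow> S (Suc i) \<noteq> {} \<and> card (S (Suc i)) \<le> 4 ^ i" for i
    proof (induction i)
      case 0
      then show ?case using cc by auto
    next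
      case (Suc i)
      show ?case
      proof
        assume i: "Suc (Suc i) \<le> \<alpha>"
        then have IH: "S (Suc i) \<noteq> {}" "card (S (Suc i)) \<le> 4 ^ i" using Suc by auto
        have "Suc (Suc i) \<in> {1..\<alpha>}" using i by simp
        then obtain l where "l \<in> lines L" "smallest_subsquare L l (S (Suc i)) (S (Suc (Suc i)))"
          using cc by (metis diff_Suc_1)
        moreover have "subsquare (S (Suc i)) L" using cc i by simp
        ultimately have "card (S (Suc (Suc i))) \<le> 4 * card (S (Suc i))" using grow IH by blast
        moreover have "S (Suc i) \<subseteq> S (Suc (Suc i))" using cc i by simp
        ultimately show "S (Suc (Suc i)) \<noteq> {} \<and> card (S (Suc (Suc i))) \<le> 4 ^ Suc i"
          using IH by auto
      qed
    qed
    from this[of "\<alpha> - 1"] have "4 ^ k \<le> (4::nat) ^ (\<alpha> - 1)" using cc cardL by auto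
    then have "k \<le> \<alpha> - 1" by simp
    then show ?thesis using cc by linarith
  qed
  have upper: "\<exists>S. connected_chain L S (k + 1)"
  proof -
    obtain r0 c0 s0 where e: "(r0, c0, s0) \<in> L"
      using cardL by (cases "L = {}") auto
    \<comment> \<open>The inclusion demanded of a chain and the condition of connectedness are kept
      together, so one choice yields both.\<close>
    define Step where "Step x y \<longleftrightarrow> x \<subseteq> y \<and> (\<exists>l\<in>lines L. intersects y l \<and> \<not> intersects x l \<and>
        smallest_subsquare L l x y)" for x y
    have single: "subsquare {(r0, c0, s0)} L"
      using e by (auto simp: subsquare_def intro: latin_squareI)
    have first: "Step {} {(r0, c0, s0)}"
    proof -
      let ?l = "{(r', c, s) \<in> L. r' = r0}"
      have "?l \<in> lines L" using rows_cols_syms_memI(1)[OF e] unfolding lines_def by blast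
      moreover have "intersects {(r0, c0, s0)} ?l" "\<not> intersects {} ?l"
        using e by (auto simp: intersects_def)
      \<comment> \<open>Over the empty set minimality means having one entry: a subsquare that meets
        a line is nonempty.\<close>
      moreover have "1 \<le> card T" if "subsquare T L" "intersects T ?l" for T
        using that finite_subset[OF _ finL]
        by (auto simp: subsquare_def intersects_def Suc_le_eq card_gt_0_iff)
      ultimately show ?thesis
        using single unfolding Step_def smallest_subsquare_def is_arg_min_linorder by auto
    qed
    have next_step: "\<exists>M. subsquare M L \<and> card M = 4 ^ Suc n \<and> Step P M"
      if P: "subsquare P L" "card P = 4 ^ n" and n: "n < k" for P n
    proof -
      have PL: "P \<subseteq> L" "latin_square P" using P by (auto simp: subsquare_def)
      have P0: "P \<noteq> {}" using P(2) by auto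
      have "card P < card L" using P(2) cardL n by simp
      \<comment> \<open>The row set determines the order and hence the number of entries, so a
        smaller subsquare misses some row of \<open>L\<close>.\<close>
      then have "rows P \<noteq> rows L" using card_latin_square L PL(2) by (metis less_irrefl)
      moreover have "rows P \<subseteq> rows L" using PL(1) by (auto simp: rows_def)
      ultimately obtain r where r: "r \<in> rows L" "r \<notin> rows P" by blast
      define l where "l = {(r', c, s) \<in> L. r' = r}"
      have l: "l \<in> lines L" using r(1) unfolding l_def lines_def by blast
      obtain M where M: "smallest_subsquare L l P M"
        using smallest_subsquare_exists[OF L l PL(1)] .
      then have M': "subsquare M L" "intersects M l" "P \<subseteq> M"
        unfolding smallest_subsquare_def is_arg_min_linorder by blast+
      have nl: "\<not> intersects P l" using r(2) by (auto simp: intersects_def l_def rows_def)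
      have rM: "r \<in> rows M" using M'(2) by (auto simp: intersects_def l_def rows_def)
      have PM: "latin_square M" "subsquare P M"
        using M' PL by (auto simp: subsquare_def)
      have "4 * card P \<le> card M" using card_proper_subsquare[OF PM rM r(2)] .
      moreover have "card M \<le> 4 * card P" using grow[OF M P(1) P0 l] .
      ultimately have "card M = 4 ^ Suc n" using P(2) by simp
      then show ?thesis using M M' nl l unfolding Step_def by blast
    qed
    \<comment> \<open>The choice principle yields an infinite sequence, so both conditions are
      guarded to be vacuous beyond \<open>k\<close>. The clause for \<open>n = 0\<close> fixes the
      start to match \<open>first\<close>.\<close>
    let ?A = "\<lambda>n x. n \<le> k \<longrightarrow> subsquare x L \<and> card x = 4 ^ n \<and> (n = 0 \<longrightarrow> x = {(r0, c0, s0)})"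
    let ?B = "\<lambda>n x y. n < k \<longrightarrow> Step x y"
    have "\<exists>S. \<forall>n. ?A n (S n) \<and> ?B n (S n) (S (Suc n))"
    proof (rule dependent_nat_choice)
      show "\<exists>x. ?A 0 x" using single by auto
      show "\<exists>y. ?A (Suc n) y \<and> ?B n x y" if "?A n x" for x n
      proof (cases "n < k")
        case True
        then show ?thesis using next_step[of x n] that by auto
      qed auto
    qed
    then obtain S where *: "\<forall>n. ?A n (S n) \<and> ?B n (S n) (S (Suc n))" ..
    note S = *[THEN spec, THEN conjunct1] *[THEN spec, THEN conjunct2]
    \<comment> \<open>Prepending the empty set shifts the indices by one, which accounts for length
      \<open>k + 1\<close>.\<close>
    define S' where "S' = case_nat {} S"
    have S0: "S 0 = {(r0, c0, s0)}" using S(1)[of 0] by simp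
    have Sk: "S k = L"
      using S(1)[of k] cardL card_subset_eq[OF finL] by (auto simp: subsquare_def)
    have step: "Step (S' i) (S' (Suc i))" if "i < k + 1" for i
      using that first S0 S(2) by (cases i) (auto simp: S'_def)
    have sub: "subsquare (S' i) L" if "i \<le> k + 1" for i
      using that S(1) by (cases i) (auto simp: S'_def subsquare_def intro: latin_squareI)
    have "chain L S' (k + 1)"
      unfolding chain_def using sub step S0 Sk by (auto simp: S'_def Step_def)
    moreover have "\<exists>l\<in>lines L. intersects (S' i) l \<and> \<not> intersects (S' (i - 1)) l \<and>
        smallest_subsquare L l (S' (i - 1)) (S' i)" if "i \<in> {1..k + 1}" for i
      using that step[of "i - 1"] by (auto simp: Step_def)
    ultimately show ?thesis unfolding connected_chain_def by blast
  qed
  show ?thesis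
    unfolding scc_def L_def[symmetric] using lower upper by (intro Least_equality) blast+
qed

end
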